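(* Let $G$ be a regular WRD refutation (a regular w-resolution dag whose final clause is $\Box$), and let $C$ be a clause labeling a node of $G$. (a) Suppose $C$ is derived from $C_0$ and $C_1$, with the edge from $C_0$ to $C$ labeled $\overline x$ and the edge from $C_1$ to $C$ labeled $x$. Then $\overline x\notin C_0$ and $x\notin C_1$. (b) Let $\alpha$ be an assignment such that $\alpha(l)=1$ for every literal $l$ labeling an edge on a path from (the node of) $C$ to the final clause. Then $C|_\alpha=0$, i.e. $\alpha(l)=0$ for every $l\in C$.
   Context: A literal is a variable $x$ or its negation $\overline{x}$; a clause is a finite set of literals; $\Box$ is the empty clause. An assignment $\alpha$ is a partial map from variables to $\{0,1\}$, extended to literals by $\alpha(\overline x)=1-\alpha(x)$; $C|_\alpha=0$ means $\alpha(l)=0$ for every $l\in C$. W-resolution: from arbitrary clauses $C_0,C_1$ and any variable $x$ infer $(C_0\setminus\{x\})\cup(C_1\setminus\{\overline x\})$. A WRD (w-resolution dag) proof from a set $F$ of clauses is a finite dag whose nodes are labeled by clauses, with a unique node of out-degree $0$ (the final clause); nodes of in-degree $0$ are labeled by clauses of $F$; every other node has in-degree $2$, is labeled by a variable $x$ and by the clause $(C_0\setminus\{x\})\cup(C_1\setminus\{\overline x\})$ where $C_0,C_1$ are the clauses of its two predecessors, the edge from $C_0$ being labeled $\overline x$ and the edge from $C_1$ labeled $x$. It is a refutation if the final clause is $\Box$. It is regular if for every variable $x$ every path contains at most one node labeled with $x$. *)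

theory Defs
  imports "HOL-Library.FSet" "Graph_Theory.Arc_Walk"
begin

datatype 'v lit = Pos 'v | Neg 'v

type_synonym 'v clause = "'v lit fset"

type_synonym 'v assignment = "'v \<rightharpoonup> bool"

text \<open>The truth values 0 and 1 are \<open>False\<close> and \<open>True\<close>; \<open>None\<close> means that the variable is
  not in the domain of the assignment.\<close>

fun lit_value :: "'v assignment \<Rightarrow> 'v lit \<Rightarrow> bool option" where
  "lit_value \<alpha> (Pos x) = \<alpha> x"
| "lit_value \<alpha> (Neg x) = map_option Not (\<alpha> x)"

definition falsifies :: "'v assignment \<Rightarrow> 'v clause \<Rightarrow> bool" where
  "falsifies \<alpha> C \<longleftrightarrow> (\<forall>l. l |\<in>| C \<longrightarrow> lit_value \<alpha> l = Some False)"

text \<open>Neither \<open>Pos x |\<in>| C0\<close> nor \<open>Neg x |\<in>| C1\<close> is required.\<close>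

definition w_resolvent :: "'v \<Rightarrow> 'v clause \<Rightarrow> 'v clause \<Rightarrow> 'v clause" where
  "w_resolvent x C0 C1 = (C0 |-| {|Pos x|}) |\<union>| (C1 |-| {|Neg x|})"

text \<open>The underlying digraph may have parallel arcs, so that a clause can be w-resolved with
  itself at a single node. A node without a variable label has \<open>var_label = None\<close>.\<close>

record ('n, 'e, 'v) wrd =
  graph_of :: "('n, 'e) pre_digraph"
  clause_label :: "'n \<Rightarrow> 'v clause"
  var_label :: "'n \<Rightarrow> 'v option"
  edge_label :: "'e \<Rightarrow> 'v lit"

definition is_final :: "('n, 'e, 'v) wrd \<Rightarrow> 'n \<Rightarrow> bool" where
  "is_final G t \<longleftrightarrow> t \<in> verts (graph_of G) \<and> out_degree (graph_of G) t = 0"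

definition initial_node :: "'v clause set \<Rightarrow> ('n, 'e, 'v) wrd \<Rightarrow> 'n \<Rightarrow> bool" where
  "initial_node F G v \<longleftrightarrow>
     in_degree (graph_of G) v = 0 \<and> clause_label G v \<in> F \<and> var_label G v = None"

definition inference_node :: "('n, 'e, 'v) wrd \<Rightarrow> 'n \<Rightarrow> bool" where
  "inference_node G v \<longleftrightarrow> in_degree (graph_of G) v = 2 \<and>
     (\<exists>x e0 e1. in_arcs (graph_of G) v = {e0, e1} \<and> var_label G v = Some x \<and>
        edge_label G e0 = Neg x \<and> edge_label G e1 = Pos x \<and>
        clause_label G v =
          w_resolvent x (clause_label G (tail (graph_of G) e0)) (clause_label G (tail (graph_of G) e1)))"

definition wrd_proof :: "'v clause set \<Rightarrow> ('n, 'e, 'v) wrd \<Rightarrow> bool" where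
  "wrd_proof F G \<longleftrightarrow>
     fin_digraph (graph_of G) \<and> acyclic (arcs_ends (graph_of G)) \<and> (\<exists>!t. is_final G t) \<and>
     (\<forall>v \<in> verts (graph_of G). initial_node F G v \<or> inference_node G v)"

definition wrd_refutation :: "'v clause set \<Rightarrow> ('n, 'e, 'v) wrd \<Rightarrow> bool" where
  "wrd_refutation F G \<longleftrightarrow> wrd_proof F G \<and> (\<forall>t. is_final G t \<longrightarrow> clause_label G t = {||})"

definition regular_wrd :: "('n, 'e, 'v) wrd \<Rightarrow> bool" where
  "regular_wrd G \<longleftrightarrow>
     (\<forall>x u p w. pre_digraph.apath (graph_of G) u p w \<longrightarrow>
        card {v \<in> set (pre_digraph.awalk_verts (graph_of G) u p). var_label G v = Some x} \<le> 1)"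

end

theory Submission
  imports Defs
begin

text \<open>Follow a path from a node to the final clause. A literal of the node's clause is absent from
  the empty clause, and the only way to lose it is to traverse an edge labeled with its complement;
  this gives (b). If, in (a), the literal \<open>Neg x\<close> were in the clause of \<open>e0\<close>'s tail, it would survive
  the inference on \<open>x\<close> and be lost later on, at a second node labeled \<open>x\<close>.\<close>

fun complement :: "'v lit \<Rightarrow> 'v lit" where
  "complement (Pos x) = Neg x"
| "complement (Neg x) = Pos x"

lemma complement_complement [simp]: "complement (complement l) = l"
  by (cases l) auto

lemma lit_value_complement: "lit_value \<alpha> (complement l) = Some True \<Longrightarrow> lit_value \<alpha> l = Some False"
  by (cases l) auto

text \<open>This form separates the start vertex from the heads of the traversed arcs, so distinct
  vertices on a path mean that no head equals the start.\<close>

lemma (in pre_digraph) awalk_verts_eq_heads: "cas u p t \<Longrightarrow> awalk_verts u p = u # map (head G) p"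
  by (induction u p t rule: cas.induct) auto

text \<open>In a finite acyclic digraph the converse of the arc relation is well-founded, so
  stepping along outgoing arcs must end. Part (a) mentions no final clause; this supplies the path
  to it, as an \<open>apath\<close> because regularity speaks of these.\<close>

lemma (in fin_digraph) acyclic_reaches_sink:
  assumes "acyclic (arcs_ends G)" and "v \<in> verts G"
  obtains p t where "apath v p t" and "out_degree G t = 0"
proof -
  have "finite (arcs_ends G)"
    by (simp add: arcs_ends_def)
  then have "wf ((arcs_ends G)\<inverse>)"
    using assms(1) by (rule finite_acyclic_wf_converse)
  then have "v \<in> verts G \<longrightarrow> (\<exists>t. v \<rightarrow>\<^sup>* t \<and> out_degree G t = 0)"
  proof (induction v rule: wf_induct_rule)
    case (less v)
    show ?case
    proof (cases "out_arcs G v = {}")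
      case True
      then show ?thesis
        by (auto simp: out_degree_def)
    next
      case False
      then obtain e where e: "e \<in> arcs G" "tail G e = v"
        by (metis all_not_in_conv in_out_arcs_conv)
      then have "v \<rightarrow> head G e"
        by (auto simp: arcs_ends_conv)
      with less e show ?thesis
        by (meson adj_reachable_trans converseI head_in_verts)
    qed
  qed
  with assms(2) that show thesis
    by (auto simp: reachable_apath)
qed

text \<open>The label of an arc tells which literal the inference removes from the premise at its
  tail: \<open>Pos x\<close> for \<open>Neg x\<close>, and \<open>Neg x\<close> for
  \<open>Pos x\<close>. Using the complement of the label treats both premises at once.\<close>

lemma wrd_proof_arc:
  assumes "wrd_proof F G" and "e \<in> arcs (graph_of G)"
  obtains x where "var_label G (head (graph_of G) e) = Some x"
    and "edge_label G e = Pos x \<or> edge_label G e = Neg x"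
    and "clause_label G (tail (graph_of G) e) |\<subseteq>|
      finsert (complement (edge_label G e)) (clause_label G (head (graph_of G) e))"
proof -
  interpret fin_digraph "graph_of G"
    using assms(1) by (simp add: wrd_proof_def)
  let ?w = "head (graph_of G) e"
  have e: "e \<in> in_arcs (graph_of G) ?w"
    using assms(2) by simp
  \<comment> \<open>The arc \<open>e\<close> enters \<open>?w\<close>, which rules out an initial
    node.\<close>
  then have "in_degree (graph_of G) ?w \<noteq> 0"
    unfolding in_degree_def by (metis card_0_eq empty_iff finite_in_arcs)
  then have "inference_node G ?w"
    using assms head_in_verts by (metis wrd_proof_def initial_node_def)
  then obtain x e0 e1 where *: "in_arcs (graph_of G) ?w = {e0, e1}"
      "var_label G ?w = Some x" "edge_label G e0 = Neg x" "edge_label G e1 = Pos x"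
      "clause_label G ?w =
        w_resolvent x (clause_label G (tail (graph_of G) e0)) (clause_label G (tail (graph_of G) e1))"
    by (auto simp: inference_node_def)
  from e *(1) have "e = e0 \<or> e = e1"
    by simp
  with * show thesis
    by (intro that[of x]) (auto simp: w_resolvent_def)
qed

text \<open>Induction on the walk from its start: across the first arc, the literal is either
  removed there or passed on to the clause at the head, where the rest of the walk begins.\<close>

lemma awalk_loses_literal:
  assumes "wrd_proof F G" and "pre_digraph.awalk (graph_of G) u p t"
    and "l |\<in>| clause_label G u" and "clause_label G t = {||}"
  shows "\<exists>e \<in> set p. edge_label G e = complement l"
proof -
  interpret fin_digraph "graph_of G"
    using assms(1) by (simp add: wrd_proof_def)
  from assms(2,3) show ?thesis
  proof (induction p arbitrary: u)
    case Nil
    with assms(4) show ?case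
      by (simp add: awalk_Nil_iff)
  next
    case (Cons e p)
    then have e: "e \<in> arcs (graph_of G)" "tail (graph_of G) e = u"
      and p: "awalk (head (graph_of G) e) p t"
      by (auto simp: awalk_Cons_iff)
    from wrd_proof_arc[OF assms(1) e(1)] e(2) Cons.prems(2)
    have "l = complement (edge_label G e) \<or> l |\<in>| clause_label G (head (graph_of G) e)"
      by blast
    with Cons.IH[OF p] show ?case
      by auto
  qed
qed

text \<open>A literal over \<open>x\<close> in the clause of \<open>v\<close> would have to be
  removed further on, at a node labeled \<open>x\<close> other than \<open>v\<close>; a path through
  both contradicts regularity.\<close>

lemma regular_refutation_avoids_resolved_var:
  assumes "wrd_refutation F G" and "regular_wrd G" and "v \<in> verts (graph_of G)"
    and "var_label G v = Some x"
  shows "Pos x |\<notin>| clause_label G v" and "Neg x |\<notin>| clause_label G v"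
proof -
  have G: "wrd_proof F G"
    using assms(1) by (simp add: wrd_refutation_def)
  then interpret fin_digraph "graph_of G"
    by (simp add: wrd_proof_def)
  obtain p t where p: "apath v p t" and "out_degree (graph_of G) t = 0"
    using acyclic_reaches_sink assms(3) G by (auto simp: wrd_proof_def)
  then have "is_final G t"
    by (auto simp: is_final_def apath_def)
  then have t: "clause_label G t = {||}"
    using assms(1) by (simp add: wrd_refutation_def)
  have walk: "awalk v p t"
    using p by (simp add: apath_def)
  have "False" if mem: "l |\<in>| clause_label G v" and l: "l = Pos x \<or> l = Neg x" for l
  proof -
    obtain e where e: "e \<in> set p" "edge_label G e = complement l"
      using awalk_loses_literal[OF G walk mem t] by blast
    let ?w = "head (graph_of G) e"
    have "e \<in> arcs (graph_of G)"
      using walk e(1) by auto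
    \<comment> \<open>The variable of an arc's label is the one resolved on at its head, and
      \<open>complement l\<close> is a literal over \<open>x\<close>.\<close>
    then have w: "var_label G ?w = Some x"
      using wrd_proof_arc[OF G] e(2) l by (metis complement.simps lit.distinct(1) lit.inject)
    have vs: "awalk_verts v p = v # map (head (graph_of G)) p"
      using walk awalk_verts_eq_heads by (auto simp: awalk_def)
    with p have "distinct (v # map (head (graph_of G)) p)"
      by (simp add: apath_def)
    with e(1) have "?w \<noteq> v"
      by auto
    moreover have "{v, ?w} \<subseteq> {u \<in> set (awalk_verts v p). var_label G u = Some x}"
      using assms(4) w vs e(1) by auto
    ultimately have "2 \<le> card {u \<in> set (awalk_verts v p). var_label G u = Some x}"
      using card_mono[of "{u \<in> set (awalk_verts v p). var_label G u = Some x}" "{v, ?w}"] by simp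
    moreover have "card {u \<in> set (awalk_verts v p). var_label G u = Some x} \<le> 1"
      using assms(2) p by (auto simp: regular_wrd_def)
    ultimately show False
      by simp
  qed
  then show "Pos x |\<notin>| clause_label G v" and "Neg x |\<notin>| clause_label G v"
    by auto
qed

theorem theorem2p4:
  fixes F :: "'v clause set" and G :: "('n, 'e, 'v) wrd" and v :: 'n
  assumes "wrd_refutation F G" and "regular_wrd G" and "v \<in> verts (graph_of G)"
  shows "(\<forall>x e0 e1.
            e0 \<in> in_arcs (graph_of G) v \<and> edge_label G e0 = Neg x \<and>
            e1 \<in> in_arcs (graph_of G) v \<and> edge_label G e1 = Pos x \<longrightarrow>
              Neg x |\<notin>| clause_label G (tail (graph_of G) e0) \<and>
              Pos x |\<notin>| clause_label G (tail (graph_of G) e1))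
       \<and> (\<forall>\<alpha> p t.
            is_final G t \<and> pre_digraph.apath (graph_of G) v p t \<and>
            (\<forall>e \<in> set p. lit_value \<alpha> (edge_label G e) = Some True) \<longrightarrow>
              falsifies \<alpha> (clause_label G v))"
proof -
  have G: "wrd_proof F G"
    using assms(1) by (simp add: wrd_refutation_def)
  \<comment> \<open>Both halves of (a) have this shape: the label of an incoming arc is absent from
    the premise at the arc's tail.\<close>
  have a: "l |\<notin>| clause_label G (tail (graph_of G) e)"
    if "e \<in> in_arcs (graph_of G) v" and l: "edge_label G e = l" for e l
  proof -
    have e: "e \<in> arcs (graph_of G)" "head (graph_of G) e = v"
      using that(1) by auto
    obtain x where x: "var_label G v = Some x" "l = Pos x \<or> l = Neg x"
      and sub: "clause_label G (tail (graph_of G) e) |\<subseteq>|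
        finsert (complement l) (clause_label G v)"
      using wrd_proof_arc[OF G e(1)] e(2) l by metis
    \<comment> \<open>The inference removes only \<open>complement l\<close> from this premise, so
      an occurrence of \<open>l\<close> there would survive into the clause of
      \<open>v\<close>.\<close>
    have "l |\<notin>| clause_label G v" "l \<noteq> complement l"
      using regular_refutation_avoids_resolved_var[OF assms x(1)] x(2) by auto
    with sub show ?thesis
      by auto
  qed
  have b: "falsifies \<alpha> (clause_label G v)"
    if "is_final G t" and "pre_digraph.apath (graph_of G) v p t"
      and "\<forall>e \<in> set p. lit_value \<alpha> (edge_label G e) = Some True" for \<alpha> p t
    unfolding falsifies_def
  proof (intro allI impI)
    fix l
    assume "l |\<in>| clause_label G v"
    moreover have "clause_label G t = {||}"
      using assms(1) that(1) by (simp add: wrd_refutation_def)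
    moreover have "pre_digraph.awalk (graph_of G) v p t"
      using that(2) by (simp add: pre_digraph.apath_def)
    \<comment> \<open>The arc on which \<open>l\<close> is lost carries its complement, which
      \<alpha> makes true.\<close>
    ultimately obtain e where "e \<in> set p" "edge_label G e = complement l"
      using awalk_loses_literal[OF G] by blast
    with that(3) have "lit_value \<alpha> (complement l) = Some True"
      by metis
    then show "lit_value \<alpha> l = Some False"
      by (rule lit_value_complement)
  qed
  from a b show ?thesis
    by blast
qed

end
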